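(* Let $N\ge1$, $\alpha\in(\mathbb{Z}/N\mathbb{Z})^\times$, $\boldsymbol{k}=(k_1,\ldots,k_r)\in\mathbb{Z}_{>0}^r$ and $\boldsymbol{\eta}=(\eta_1,\ldots,\eta_r)\in\mu_N^r$. Then, in $\mathcal{A}(\alpha)$, \[L^{\mathcal{A}}_\alpha\binom{\boldsymbol{\eta}}{\boldsymbol{k}}=\left(z_p\left(\begin{array}{c}\boldsymbol{\eta}\\\boldsymbol{k}\end{array};\zeta_p\right)\bmod\mathfrak{P}\right)_{p\in\mathcal{P}(N;\alpha)}.\]
   Context: $\mu_N$ is the set of $N$-th roots of unity. $\mathcal{P}(N;\alpha)$ is the set of primes $p\equiv\alpha\pmod N$. For a prime $p$, $\zeta_p$ is a primitive $p$-th root of unity and $\mathfrak{P}$ is a prime ideal of $\mathbb{Z}[\zeta_{pN}]$ lying above the ideal $(1-\zeta_p)$ of $\mathbb{Z}[\zeta_p]$; the residue field $\mathbb{Z}[\zeta_{pN}]/\mathfrak{P}$ is regarded as a subfield of $\overline{\mathbb{F}}_p$. Set $\mathcal{A}(\alpha)=\prod_{p\in\mathcal{P}(N;\alpha)}\overline{\mathbb{F}}_p\big/\bigoplus_{p\in\mathcal{P}(N;\alpha)}\overline{\mathbb{F}}_p$. For a positive integer $n$, $z_n\left(\begin{smallmatrix}\eta_1,\ldots,\eta_r\\k_1,\ldots,k_r\end{smallmatrix};\zeta_n\right)=\sum_{n>m_1>\cdots>m_r>0}\prod_{j=1}^r\eta_j^{m_j}\left(\frac{1-\zeta_n}{1-\zeta_n^{m_j}}\right)^{k_j}$;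 for $n=p$ prime this lies in $\mathbb{Z}[\zeta_{pN}]$. The finite colored multiple zeta value of level $N$ is \[L^{\mathcal{A}}_\alpha\binom{\eta_1,\ldots,\eta_r}{k_1,\ldots,k_r}=\left(\sum_{p>m_1>\cdots>m_r>0}\frac{\eta_1^{m_1}\cdots\eta_r^{m_r}}{m_1^{k_1}\cdots m_r^{k_r}}\bmod\mathfrak{P}\right)_{p\in\mathcal{P}(N;\alpha)}\in\mathcal{A}(\alpha).\] *)

theory Defs
  imports
    Complex_Main
    "HOL-Library.FuncSet"
    "HOL-Computational_Algebra.Polynomial"
    "HOL-Number_Theory.Residues"
    "HOL-Algebra.QuotRing"
    "HOL-Algebra.Algebraic_Closure"
begin

subsection \<open>Cyclotomic rings and residue fields\<close>

definition primitive_root_of_unity :: "nat \<Rightarrow> complex \<Rightarrow> bool" where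
  "primitive_root_of_unity n z \<longleftrightarrow> n > 0 \<and> z ^ n = 1 \<and> (\<forall>k. 0 < k \<and> k < n \<longrightarrow> z ^ k \<noteq> 1)"

text \<open>The subring \<open>\<int>[z]\<close> of the complex numbers.\<close>

definition int_adjoin :: "complex \<Rightarrow> complex ring" where
  "int_adjoin z =
     \<lparr>carrier = range (\<lambda>f :: int poly. poly (map_poly of_int f) z),
      mult = (*), one = 1, zero = 0, add = (+)\<rparr>"

text \<open>
  Reduction modulo a prime ideal \<open>P\<close> with field \<open>R Quot P\<close>, defined on the localization of the
  subring \<open>R\<close> of the complex numbers at \<open>P\<close>: the class of \<open>a / b\<close> with \<open>a, b \<in> R\<close> and
  \<open>b \<notin> P\<close> is the class of \<open>a\<close> times the inverse of the class of \<open>b\<close>.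
\<close>

definition reduce_mod :: "complex ring \<Rightarrow> complex set \<Rightarrow> complex \<Rightarrow> complex set" where
  "reduce_mod R P x =
     (THE y. \<exists>a \<in> carrier R. \<exists>b \<in> carrier R - P.
        x = a / b \<and> y = (P +>\<^bsub>R\<^esub> a) \<otimes>\<^bsub>R Quot P\<^esub> inv\<^bsub>R Quot P\<^esub> (P +>\<^bsub>R\<^esub> b))"

lemma int_adjoin_cring: "cring (int_adjoin z)"
proof -
  let ?e = "\<lambda>f :: int poly. poly (map_poly of_int f) z :: complex"
  have pCons: "?e (pCons a f) = of_int a + z * ?e f" for a f
    by (simp add: map_poly_pCons)
  have add: "?e f + ?e g = ?e (f + g)" for f g
    by (induction f g rule: poly_induct2) (simp_all add: pCons algebra_simps flip: distrib_left)
  have smult: "of_int a * ?e f = ?e (Polynomial.smult a f)" for a f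
    by (induction f) (simp_all add: pCons algebra_simps)
  have mult: "?e f * ?e g = ?e (f * g)" for f g
    by (induction f) (simp_all add: pCons algebra_simps smult flip: add)
  have uminus: "- ?e f = ?e (- f)" for f
    using smult[of "-1" f] by simp
  have closed: "range ?e = S \<Longrightarrow> 0 \<in> S \<and> 1 \<in> S \<and> (\<forall>x\<in>S. - x \<in> S)
      \<and> (\<forall>x\<in>S. \<forall>y\<in>S. x + y \<in> S \<and> x * y \<in> S)" for S
    using rangeI[of ?e 0] rangeI[of ?e 1] by (auto simp: add mult uminus)
  define S where "S = range ?e"
  note c = closed[OF S_def[symmetric]]
  have carr: "int_adjoin z = \<lparr>carrier = S, mult = (*), one = 1, zero = 0, add = (+)\<rparr>"
    by (simp add: int_adjoin_def S_def)
  show ?thesis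
    unfolding carr
  proof (rule cringI)
    show "abelian_group \<lparr>carrier = S, mult = (*), one = 1, zero = 0, add = (+)\<rparr>"
    proof (rule abelian_groupI)
      fix x assume "x \<in> carrier \<lparr>carrier = S, mult = (*), one = 1, zero = 0, add = (+)\<rparr>"
      then show "\<exists>y\<in>carrier \<lparr>carrier = S, mult = (*), one = 1, zero = 0, add = (+)\<rparr>.
          y \<oplus>\<^bsub>\<lparr>carrier = S, mult = (*), one = 1, zero = 0, add = (+)\<rparr>\<^esub> x
            = \<zero>\<^bsub>\<lparr>carrier = S, mult = (*), one = 1, zero = 0, add = (+)\<rparr>\<^esub>"
        using c by (intro bexI[of _ "- x"]) auto
    qed (use c in \<open>auto simp: algebra_simps\<close>)
    show "Group.comm_monoid \<lparr>carrier = S, mult = (*), one = 1, zero = 0, add = (+)\<rparr>"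
      using c by (intro comm_monoidI) (auto simp: algebra_simps)
  qed (auto simp: algebra_simps)
qed

subsection \<open>The ring \<open>\<A>(\<alpha>)\<close>\<close>

definition primes_cong :: "nat \<Rightarrow> int \<Rightarrow> nat set" where
  "primes_cong N \<alpha> = {p. Factorial_Ring.prime p \<and> [int p = \<alpha>] (mod int N)}"

type_synonym Fbar_elem = "(int list \<times> nat) multiset \<Rightarrow> int"

definition Fbar :: "nat \<Rightarrow> Fbar_elem ring" where
  "Fbar p = field.alg_closure (residue_ring (int p))"

definition prod_ring :: "'i set \<Rightarrow> ('i \<Rightarrow> 'a ring) \<Rightarrow> ('i \<Rightarrow> 'a) ring" where
  "prod_ring I F =
     \<lparr>carrier = (\<Pi>\<^sub>E i\<in>I. carrier (F i)),
      mult = (\<lambda>x y. \<lambda>i\<in>I. x i \<otimes>\<^bsub>F i\<^esub> y i), one = (\<lambda>i\<in>I. \<one>\<^bsub>F i\<^esub>),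
      zero = (\<lambda>i\<in>I. \<zero>\<^bsub>F i\<^esub>), add = (\<lambda>x y. \<lambda>i\<in>I. x i \<oplus>\<^bsub>F i\<^esub> y i)\<rparr>"

definition direct_sum :: "'i set \<Rightarrow> ('i \<Rightarrow> 'a ring) \<Rightarrow> ('i \<Rightarrow> 'a) set" where
  "direct_sum I F = {x \<in> carrier (prod_ring I F). finite {i \<in> I. x i \<noteq> \<zero>\<^bsub>F i\<^esub>}}"

definition ring_A :: "nat \<Rightarrow> int \<Rightarrow> (nat \<Rightarrow> Fbar_elem) set ring" where
  "ring_A N \<alpha> = prod_ring (primes_cong N \<alpha>) Fbar Quot direct_sum (primes_cong N \<alpha>) Fbar"

text \<open>The class in \<open>\<A>(\<alpha>)\<close> of the family \<open>x\<close> indexed by the primes congruent to \<open>\<alpha>\<close>.\<close>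

definition class_A :: "nat \<Rightarrow> int \<Rightarrow> (nat \<Rightarrow> Fbar_elem) \<Rightarrow> (nat \<Rightarrow> Fbar_elem) set" where
  "class_A N \<alpha> x =
     direct_sum (primes_cong N \<alpha>) Fbar +>\<^bsub>prod_ring (primes_cong N \<alpha>) Fbar\<^esub>
       restrict x (primes_cong N \<alpha>)"

lemma Fbar_algebraic_closure:
  assumes "Factorial_Ring.prime p"
  shows "algebraic_closure (Fbar p)
           (ring.indexed_const (residue_ring (int p)) ` carrier (residue_ring (int p)))"
proof -
  interpret residues_prime p "residue_ring (int p)"
    using assms by unfold_locales (auto simp: prime_gt_1_nat)
  show ?thesis unfolding Fbar_def by (rule field.alg_closureE[OF is_field])
qed

lemma prod_ring_cring:
  assumes "\<And>i. i \<in> I \<Longrightarrow> cring (F i)"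
  shows "cring (prod_ring I F)"
proof -
  have r: "ring (F i)" if "i \<in> I" for i using assms[OF that] by (rule cring.axioms)
  note s = cring.cring_simprules[OF assms] monoid.r_one[OF ring.is_monoid[OF cring.axioms(1)[OF assms]]]
  show ?thesis
  proof (rule cringI)
    show "abelian_group (prod_ring I F)"
    proof (rule abelian_groupI)
      fix x assume x: "x \<in> carrier (prod_ring I F)"
      show "\<exists>y\<in>carrier (prod_ring I F). y \<oplus>\<^bsub>prod_ring I F\<^esub> x = \<zero>\<^bsub>prod_ring I F\<^esub>"
        using x by (intro bexI[of _ "\<lambda>i\<in>I. \<ominus>\<^bsub>F i\<^esub> x i"])
          (auto simp: prod_ring_def s PiE_iff fun_eq_iff)
    qed (auto simp: prod_ring_def s PiE_iff fun_eq_iff extensional_def)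
    show "Group.comm_monoid (prod_ring I F)"
      by (rule comm_monoidI) (auto simp: prod_ring_def s PiE_iff fun_eq_iff extensional_def)
  qed (auto simp: prod_ring_def s PiE_iff fun_eq_iff)
qed

lemma direct_sum_ideal:
  assumes "\<And>i. i \<in> I \<Longrightarrow> cring (F i)"
  shows "ideal (direct_sum I F) (prod_ring I F)"
proof -
  interpret Q: cring "prod_ring I F" by (rule prod_ring_cring[OF assms])
  note s = cring.cring_simprules[OF assms]
  have inv: "\<ominus>\<^bsub>prod_ring I F\<^esub> x = (\<lambda>i\<in>I. \<ominus>\<^bsub>F i\<^esub> x i)" if x: "x \<in> carrier (prod_ring I F)" for x
    by (rule Q.minus_equality) (use x in \<open>auto simp: prod_ring_def s PiE_iff fun_eq_iff\<close>)
  have add: "x \<oplus>\<^bsub>prod_ring I F\<^esub> y \<in> direct_sum I F"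
    if x: "x \<in> direct_sum I F" and y: "y \<in> direct_sum I F" for x y
  proof -
    have "finite ({i \<in> I. x i \<noteq> \<zero>\<^bsub>F i\<^esub>} \<union> {i \<in> I. y i \<noteq> \<zero>\<^bsub>F i\<^esub>})"
      using x y by (simp add: direct_sum_def)
    moreover have "{i \<in> I. (x \<oplus>\<^bsub>prod_ring I F\<^esub> y) i \<noteq> \<zero>\<^bsub>F i\<^esub>}
        \<subseteq> {i \<in> I. x i \<noteq> \<zero>\<^bsub>F i\<^esub>} \<union> {i \<in> I. y i \<noteq> \<zero>\<^bsub>F i\<^esub>}"
      by (auto simp: prod_ring_def s)
    ultimately show ?thesis
      using x y Q.a_closed by (auto simp: direct_sum_def intro: finite_subset)
  qed
  have neg: "\<ominus>\<^bsub>prod_ring I F\<^esub> x \<in> direct_sum I F" if x: "x \<in> direct_sum I F" for x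
  proof -
    have xc: "x \<in> carrier (prod_ring I F)" using x by (simp add: direct_sum_def)
    have "{i \<in> I. (\<ominus>\<^bsub>prod_ring I F\<^esub> x) i \<noteq> \<zero>\<^bsub>F i\<^esub>} \<subseteq> {i \<in> I. x i \<noteq> \<zero>\<^bsub>F i\<^esub>}"
      by (auto simp: inv[OF xc] s)
    then show ?thesis
      using x Q.a_inv_closed[OF xc] by (auto simp: direct_sum_def intro: finite_subset)
  qed
  have mult: "y \<otimes>\<^bsub>prod_ring I F\<^esub> x \<in> direct_sum I F"
    if x: "x \<in> direct_sum I F" and y: "y \<in> carrier (prod_ring I F)" for x y
  proof -
    have yi: "y i \<in> carrier (F i)" if "i \<in> I" for i
      using y that by (auto simp: prod_ring_def)
    have "{i \<in> I. (y \<otimes>\<^bsub>prod_ring I F\<^esub> x) i \<noteq> \<zero>\<^bsub>F i\<^esub>} \<subseteq> {i \<in> I. x i \<noteq> \<zero>\<^bsub>F i\<^esub>}"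
      using yi by (auto simp: prod_ring_def s cring.axioms(1)[OF assms, THEN ring.ring_simprules(25)])
    then show ?thesis
      using x y Q.m_closed by (auto simp: direct_sum_def intro: finite_subset)
  qed
  have zero: "\<zero>\<^bsub>prod_ring I F\<^esub> \<in> direct_sum I F"
    using Q.zero_closed by (auto simp: direct_sum_def prod_ring_def)
  have sub: "x \<in> carrier (prod_ring I F)" if "x \<in> direct_sum I F" for x
    using that by (simp add: direct_sum_def)
  show ?thesis
  proof (rule idealI[OF Q.ring_axioms])
    show "subgroup (direct_sum I F) (add_monoid (prod_ring I F))"
      using zero add neg sub by (intro Q.add.subgroupI) (auto simp: a_inv_def[symmetric])
  next
    fix x y assume "x \<in> direct_sum I F" "y \<in> carrier (prod_ring I F)"
    then show "y \<otimes>\<^bsub>prod_ring I F\<^esub> x \<in> direct_sum I F" "x \<otimes>\<^bsub>prod_ring I F\<^esub> y \<in> direct_sum I F"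
      using mult sub by (simp_all add: Q.m_comm)
  qed
qed

lemma Fbar_cring:
  assumes "p \<in> primes_cong N \<alpha>"
  shows "cring (Fbar p)"
proof -
  interpret algebraic_closure "Fbar p"
      "ring.indexed_const (residue_ring (int p)) ` carrier (residue_ring (int p))"
    using assms by (intro Fbar_algebraic_closure) (simp add: primes_cong_def)
  show ?thesis by (rule is_cring)
qed

lemma ring_A_cring: "cring (ring_A N \<alpha>)"
  unfolding ring_A_def
  by (intro ideal.quotient_is_cring direct_sum_ideal prod_ring_cring Fbar_cring)

lemma class_A_closed:
  assumes "\<And>p. p \<in> primes_cong N \<alpha> \<Longrightarrow> x p \<in> carrier (Fbar p)"
  shows "class_A N \<alpha> x \<in> carrier (ring_A N \<alpha>)"
proof -
  have "restrict x (primes_cong N \<alpha>) \<in> carrier (prod_ring (primes_cong N \<alpha>) Fbar)"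
    using assms by (simp add: prod_ring_def)
  then show ?thesis
    by (auto simp: class_A_def ring_A_def FactRing_def A_RCOSETS_def')
qed

subsection \<open>The sums\<close>

text \<open>Tuples \<open>n > m\<^sub>1 > \<dots> > m\<^sub>r > 0\<close>.\<close>

definition decreasing_tuples :: "nat \<Rightarrow> nat \<Rightarrow> nat list set" where
  "decreasing_tuples n r = {ms. length ms = r \<and> sorted_wrt (>) ms \<and> set ms \<subseteq> {0<..<n}}"

definition z_sum :: "complex list \<Rightarrow> nat list \<Rightarrow> nat \<Rightarrow> complex \<Rightarrow> complex" where
  "z_sum \<eta> k n \<zeta> =
     (\<Sum>m\<in>decreasing_tuples n (length k). \<Prod>j<length k.
        (\<eta> ! j) ^ (m ! j) * ((1 - \<zeta>) / (1 - \<zeta> ^ (m ! j))) ^ (k ! j))"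

definition colored_sum :: "complex list \<Rightarrow> nat list \<Rightarrow> nat \<Rightarrow> complex" where
  "colored_sum \<eta> k p =
     (\<Sum>m\<in>decreasing_tuples p (length k).
        (\<Prod>j<length k. (\<eta> ! j) ^ (m ! j)) / (\<Prod>j<length k. of_nat (m ! j) ^ (k ! j)))"

text \<open>
  In the following, \<open>\<zeta> n\<close> is a primitive \<open>n\<close>-th root of unity, \<open>P p\<close> is the chosen prime of
  \<open>\<int>[\<zeta> (p * N)]\<close>, and \<open>\<iota> p\<close> embeds its residue field into \<open>Fbar p\<close>.
\<close>

definition mod_family ::
  "nat \<Rightarrow> (nat \<Rightarrow> complex) \<Rightarrow> (nat \<Rightarrow> complex set) \<Rightarrow> (nat \<Rightarrow> complex set \<Rightarrow> Fbar_elem)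
     \<Rightarrow> (nat \<Rightarrow> complex) \<Rightarrow> nat \<Rightarrow> Fbar_elem" where
  "mod_family N \<zeta> P \<iota> x p = \<iota> p (reduce_mod (int_adjoin (\<zeta> (p * N))) (P p) (x p))"

definition finite_colored_mzv ::
  "nat \<Rightarrow> int \<Rightarrow> (nat \<Rightarrow> complex) \<Rightarrow> (nat \<Rightarrow> complex set) \<Rightarrow> (nat \<Rightarrow> complex set \<Rightarrow> Fbar_elem)
     \<Rightarrow> complex list \<Rightarrow> nat list \<Rightarrow> (nat \<Rightarrow> Fbar_elem) set" where
  "finite_colored_mzv N \<alpha> \<zeta> P \<iota> \<eta> k =
     class_A N \<alpha> (mod_family N \<zeta> P \<iota> (\<lambda>p. colored_sum \<eta> k p))"

end

theory Submission
  imports Defs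
begin

text \<open>
  Write \<open>1 - \<zeta>\<^sup>m = (1 - \<zeta>) (1 + \<zeta> + \<dots> + \<zeta>\<^sup>m\<^sup>-\<^sup>1)\<close>. Since \<open>\<zeta>\<close> is \<open>1\<close> modulo \<open>\<PP>\<close>, the second factor is
  \<open>m\<close> modulo \<open>\<PP>\<close>, a unit for \<open>0 < m < p\<close>; hence \<open>(1 - \<zeta>) / (1 - \<zeta>\<^sup>m)\<close> and \<open>1 / m\<close> agree in the residue
  field of the localization at \<open>\<PP>\<close>, and the two sums agree termwise, for every prime \<open>p\<close>.
\<close>

section \<open>Roots of unity and the rings generated by them\<close>

text \<open>Counting: the powers of \<open>z\<close> with exponents below \<open>n\<close> are
  pairwise distinct roots of \<open>X ^ n - 1\<close>, which has exactly \<open>n\<close> complex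
  roots, so they exhaust these roots.\<close>

lemma primitive_root_of_unity_powers:
  assumes "primitive_root_of_unity n z" and "x ^ n = 1"
  obtains i where "x = z ^ i"
proof -
  have n: "n > 0" and zn: "z ^ n = 1" and min: "\<And>k. 0 < k \<Longrightarrow> k < n \<Longrightarrow> z ^ k \<noteq> 1"
    using assms(1) by (auto simp: primitive_root_of_unity_def)
  have nz: "z \<noteq> 0" using zn n by (auto simp: zero_power)
  have "z ^ i \<noteq> z ^ j" if "i < j" "j < n" for i j
  proof
    assume "z ^ i = z ^ j"
    moreover have "z ^ j = z ^ i * z ^ (j - i)"
      using that by (metis less_imp_le power_add le_add_diff_inverse)
    ultimately have "z ^ (j - i) = 1" using nz by simp
    then show False using min[of "j - i"] that by simp
  qed
  then have "inj_on ((^) z) {..<n}"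
    by (intro inj_onI) (metis lessThan_iff linorder_neqE_nat)
  then have "card ((^) z ` {..<n}) = card {y :: complex. y ^ n = 1}"
    using card_roots_unity_eq[OF n] by (simp add: card_image)
  moreover have "(^) z ` {..<n} \<subseteq> {y. y ^ n = 1}"
    using zn by (auto simp: power_mult[symmetric] mult.commute[of _ n]) (simp add: power_mult)
  ultimately have "(^) z ` {..<n} = {y. y ^ n = 1}"
    using n by (intro card_subset_eq finite_roots_unity) auto
  then show ?thesis using assms(2) that by blast
qed

lemma int_adjoin_simps [simp]:
  "mult (int_adjoin z) = (*)" "one (int_adjoin z) = 1"
  "zero (int_adjoin z) = 0" "add (int_adjoin z) = (+)"
  by (simp_all add: int_adjoin_def)

lemma int_adjoin_a_inv [simp]: "x \<in> carrier (int_adjoin z) \<Longrightarrow> \<ominus>\<^bsub>int_adjoin z\<^esub> x = - x"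
proof -
  interpret cring "int_adjoin z" by (rule int_adjoin_cring)
  assume x: "x \<in> carrier (int_adjoin z)"
  then have "\<ominus>\<^bsub>int_adjoin z\<^esub> x + x = 0" using l_neg by simp
  then show ?thesis by (simp add: eq_neg_iff_add_eq_0)
qed

lemma int_adjoin_a_minus [simp]:
  "x \<in> carrier (int_adjoin z) \<Longrightarrow> y \<in> carrier (int_adjoin z) \<Longrightarrow> x \<ominus>\<^bsub>int_adjoin z\<^esub> y = x - y"
  by (simp add: a_minus_def)

context
  fixes z :: complex
begin

interpretation cring "int_adjoin z" by (rule int_adjoin_cring)

lemma int_adjoin_closed:
  assumes "x \<in> carrier (int_adjoin z)" "y \<in> carrier (int_adjoin z)"
  shows "x + y \<in> carrier (int_adjoin z)" "x * y \<in> carrier (int_adjoin z)"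
    "x - y \<in> carrier (int_adjoin z)"
  using a_closed[OF assms] m_closed[OF assms] minus_closed[OF assms] assms by simp_all

lemma int_adjoin_uminus: "x \<in> carrier (int_adjoin z) \<Longrightarrow> - x \<in> carrier (int_adjoin z)"
  using a_inv_closed[of x] by simp

lemma int_adjoin_const:
  "0 \<in> carrier (int_adjoin z)" "1 \<in> carrier (int_adjoin z)"
  using zero_closed one_closed by simp_all

lemma int_adjoin_of_nat: "of_nat m \<in> carrier (int_adjoin z)"
  by (induction m) (simp_all add: int_adjoin_const int_adjoin_closed)

lemma int_adjoin_of_int: "of_int m \<in> carrier (int_adjoin z)"
  by (cases m rule: int_cases2) (simp_all add: int_adjoin_of_nat int_adjoin_uminus)

lemma int_adjoin_power: "x \<in> carrier (int_adjoin z) \<Longrightarrow> x ^ m \<in> carrier (int_adjoin z)"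
  by (induction m) (simp_all add: int_adjoin_const int_adjoin_closed)

lemma int_adjoin_sum:
  "(\<And>i. i \<in> A \<Longrightarrow> f i \<in> carrier (int_adjoin z)) \<Longrightarrow> sum f A \<in> carrier (int_adjoin z)"
  by (induction A rule: infinite_finite_induct) (simp_all add: int_adjoin_const int_adjoin_closed)

lemma int_adjoin_generator: "z \<in> carrier (int_adjoin z)"
proof -
  have "z = poly (map_poly of_int [:0, 1 :: int:]) z" by (simp add: map_poly_pCons)
  then show ?thesis unfolding int_adjoin_def by auto
qed

end

text \<open>Exponents reduce modulo \<open>n\<close>, and the new coefficient at \<open>j\<close>
  collects the old ones at all exponents congruent to \<open>j\<close>. Thus \<open>n\<close> powers
  of \<open>z\<close> generate the ring as an abelian group; no uniqueness of coefficients is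
  claimed.\<close>

lemma int_adjoin_normal_form:
  assumes "z ^ n = 1" and "n > 0" and "x \<in> carrier (int_adjoin z)"
  obtains c :: "nat \<Rightarrow> int" where "x = (\<Sum>j<n. of_int (c j) * z ^ j)"
proof -
  obtain f :: "int poly" where f: "x = poly (map_poly of_int f) z"
    using assms(3) by (auto simp: int_adjoin_def)
  have red: "z ^ i = z ^ (i mod n)" for i
  proof -
    have "z ^ i = z ^ (n * (i div n) + i mod n)" by simp
    also have "\<dots> = z ^ (i mod n)" unfolding power_add power_mult using assms(1) by simp
    finally show ?thesis .
  qed
  let ?c = "\<lambda>j. \<Sum>i | i \<in> {..Polynomial.degree f} \<and> i mod n = j. Polynomial.coeff f i"
  have "x = (\<Sum>i\<le>Polynomial.degree f. of_int (Polynomial.coeff f i) * z ^ (i mod n))"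
    unfolding f by (simp add: poly_altdef coeff_map_poly red[symmetric] degree_map_poly)
  also have "\<dots> = (\<Sum>j<n. \<Sum>i | i \<in> {..Polynomial.degree f} \<and> i mod n = j. of_int (Polynomial.coeff f i) * z ^ (i mod n))"
    using assms(2) by (intro sum.group[symmetric]) auto
  also have "\<dots> = (\<Sum>j<n. of_int (?c j) * z ^ j)"
    by (intro sum.cong refl) (simp add: sum_distrib_right)
  finally show ?thesis by (rule that)
qed

section \<open>Prime ideals containing a positive integer, and their residue fields\<close>

text \<open>The assumptions on \<open>n\<close> make the ring finitely generated as an abelian
  group, and those on \<open>p\<close> make \<open>p\<close> annihilate the quotient; together they
  force a finite quotient. In the application \<open>n\<close> is the product
  \<open>p * N\<close>.\<close>

locale residue_char_prime = primeideal P "int_adjoin z"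
  for z :: complex and P :: "complex set" +
  fixes n p :: nat
  assumes root_of_unity: "z ^ n = 1" and n_pos: "n > 0"
    and p_pos: "p > 0" and p_mem: "of_nat p \<in> P"
begin

abbreviation R where "R \<equiv> carrier (int_adjoin z)"

lemma P_closed:
  assumes "x \<in> P"
  shows "x \<in> R" "y \<in> P \<Longrightarrow> x + y \<in> P" "y \<in> P \<Longrightarrow> x - y \<in> P" "y \<in> R \<Longrightarrow> x * y \<in> P" "y \<in> R \<Longrightarrow> y * x \<in> P"
proof -
  show "x \<in> R" using assms a_subset by auto
  show mult: "x * y \<in> P" if "y \<in> R" using I_r_closed[OF assms that] by simp
  show "y * x \<in> P" if "y \<in> R" using I_l_closed[OF assms that] by simp
  show "x + y \<in> P" if "y \<in> P" using additive_subgroup.a_closed[OF is_additive_subgroup assms that] by simp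
  show "x - y \<in> P" if "y \<in> P"
  proof -
    have "- 1 * y \<in> P"
      using I_l_closed[OF that, of "- 1"] by (simp add: int_adjoin_const int_adjoin_uminus)
    then show ?thesis using additive_subgroup.a_closed[OF is_additive_subgroup assms, of "- y"] by simp
  qed
qed

lemma P_zero: "0 \<in> P"
  using additive_subgroup.zero_closed[OF is_additive_subgroup] by simp

lemma P_sum: "(\<And>i. i \<in> A \<Longrightarrow> f i \<in> P) \<Longrightarrow> sum f A \<in> P"
  by (induction A rule: infinite_finite_induct) (auto simp: P_closed P_zero)

lemma P_one: "1 \<notin> P"
  using one_imp_carrier I_notcarr by auto

lemma P_mult: "x \<in> R \<Longrightarrow> y \<in> R \<Longrightarrow> x \<notin> P \<Longrightarrow> y \<notin> P \<Longrightarrow> x * y \<notin> P"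
  using I_prime[of x y] by auto

lemma coset_eq_iff: "x \<in> R \<Longrightarrow> y \<in> R \<Longrightarrow> P +>\<^bsub>int_adjoin z\<^esub> x = P +>\<^bsub>int_adjoin z\<^esub> y \<longleftrightarrow> x - y \<in> P"
  using quotient_eq_iff_same_a_r_cos[OF is_ideal, of x y] by simp

text \<open>As \<open>p\<close> lies in \<open>P\<close>, the coefficients of a normal form can be
  reduced modulo \<open>p\<close>, which leaves at most \<open>p ^ n\<close> classes.\<close>

lemma quotient_finite: "finite (carrier (int_adjoin z Quot P))"
proof -
  let ?e = "\<lambda>c. \<Sum>j<n. of_int (c j) * z ^ j"
  let ?C = "PiE {..<n} (\<lambda>_. {0..<int p})"
  have eR: "?e c \<in> R" for c
    by (intro int_adjoin_sum int_adjoin_closed int_adjoin_power int_adjoin_generator int_adjoin_of_int)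
  have "carrier (int_adjoin z Quot P) \<subseteq> (\<lambda>c. P +>\<^bsub>int_adjoin z\<^esub> ?e c) ` ?C"
  proof
    fix Y assume "Y \<in> carrier (int_adjoin z Quot P)"
    then obtain x where x: "x \<in> R" and Y: "Y = P +>\<^bsub>int_adjoin z\<^esub> x"
      by (auto simp: FactRing_def A_RCOSETS_def')
    obtain c where c: "x = ?e c"
      using int_adjoin_normal_form[OF root_of_unity n_pos x] by blast
    \<comment> \<open>Restricting the reduced coefficients to \<open>{..<n}\<close> makes them an
      extensional function, hence an element of the finite set \<open>?C\<close>.\<close>
    let ?d = "\<lambda>j\<in>{..<n}. c j mod int p"
    have "x - ?e ?d = (\<Sum>j<n. of_int (c j - c j mod int p) * z ^ j)"
      unfolding c sum_subtractf[symmetric] by (intro sum.cong) (auto simp: algebra_simps)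
    also have "\<dots> = (\<Sum>j<n. of_nat p * (of_int (c j div int p) * z ^ j))"
      by (intro sum.cong refl) (simp add: minus_mod_eq_mult_div)
    also have "\<dots> \<in> P"
      by (intro P_sum P_closed(4)[OF p_mem] int_adjoin_closed int_adjoin_of_int int_adjoin_power
          int_adjoin_generator)
    finally have "Y = P +>\<^bsub>int_adjoin z\<^esub> ?e ?d"
      unfolding Y using coset_eq_iff[OF x eR] by blast
    moreover have "?d \<in> ?C" using p_pos by auto
    ultimately show "Y \<in> (\<lambda>c. P +>\<^bsub>int_adjoin z\<^esub> ?e c) ` ?C" by blast
  qed
  then show ?thesis by (rule finite_subset) (intro finite_imageI finite_PiE, auto)
qed

text \<open>A finite domain is a field: multiplication by a nonzero element is injective, hence
  surjective, and so takes the value one. This supplies the inverses that occur in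
  \<open>reduce_mod\<close>.\<close>

lemma quotient_field: "field (int_adjoin z Quot P)"
proof -
  interpret Q: domain "int_adjoin z Quot P" by (rule quotient_is_domain)
  show ?thesis
  proof (rule Q.cring_fieldI2)
    fix a assume a: "a \<in> carrier (int_adjoin z Quot P)" "a \<noteq> \<zero>\<^bsub>int_adjoin z Quot P\<^esub>"
    let ?f = "\<lambda>x. a \<otimes>\<^bsub>int_adjoin z Quot P\<^esub> x"
    have "inj_on ?f (carrier (int_adjoin z Quot P))"
      using a by (intro inj_onI) (simp add: Q.m_lcancel)
    moreover have "?f ` carrier (int_adjoin z Quot P) \<subseteq> carrier (int_adjoin z Quot P)"
      using a by auto
    ultimately have "?f ` carrier (int_adjoin z Quot P) = carrier (int_adjoin z Quot P)"
      by (intro endo_inj_surj quotient_finite)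
    then show "\<exists>b\<in>carrier (int_adjoin z Quot P). a \<otimes>\<^bsub>int_adjoin z Quot P\<^esub> b = \<one>\<^bsub>int_adjoin z Quot P\<^esub>"
      by (metis Q.one_closed imageE)
  qed (use Q.one_not_zero in auto)
qed

section \<open>Congruence in the localization at the prime ideal\<close>

text \<open>Fractions are taken as complex numbers rather than as classes of pairs, in accordance
  with \<open>reduce_mod\<close>, whose argument is a complex number.\<close>

definition local_ring where "local_ring = {a / b |a b. a \<in> R \<and> b \<in> R - P}"

text \<open>This is the maximal ideal of the localization, the kernel of the reduction to the
  residue field.\<close>

definition local_max where "local_max = {a / b |a b. a \<in> P \<and> b \<in> R - P}"

text \<open>Membership of both sides in the localization is part of the relation, so that
  congruences can be multiplied without side conditions and both sides have fractions to which
  \<open>reduce_mod\<close> applies.\<close>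

definition loc_cong (infix \<open>\<approx>\<close> 50)
  where "x \<approx> y \<longleftrightarrow> x \<in> local_ring \<and> y \<in> local_ring \<and> x - y \<in> local_max"

lemma local_ringI: "a \<in> R \<Longrightarrow> b \<in> R \<Longrightarrow> b \<notin> P \<Longrightarrow> a / b \<in> local_ring"
  unfolding local_ring_def by blast

lemma local_maxI: "a \<in> P \<Longrightarrow> b \<in> R \<Longrightarrow> b \<notin> P \<Longrightarrow> a / b \<in> local_max"
  unfolding local_max_def by blast

lemma local_ring_R: "a \<in> R \<Longrightarrow> a \<in> local_ring"
  using local_ringI[of a 1] P_one by (simp add: int_adjoin_const)

lemma local_ring_mult:
  assumes "x \<in> local_ring" "y \<in> local_ring"
  shows "x * y \<in> local_ring"
proof -
  obtain a b c d where "x = a / b" "a \<in> R" "b \<in> R" "b \<notin> P"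
    and "y = c / d" "c \<in> R" "d \<in> R" "d \<notin> P"
    using assms by (auto simp: local_ring_def)
  then show ?thesis by (simp add: local_ringI int_adjoin_closed P_mult)
qed

lemma local_ring_add:
  assumes "x \<in> local_ring" "y \<in> local_ring"
  shows "x + y \<in> local_ring"
proof -
  obtain a b c d where ab: "x = a / b" "a \<in> R" "b \<in> R" "b \<notin> P"
    and cd: "y = c / d" "c \<in> R" "d \<in> R" "d \<notin> P"
    using assms by (auto simp: local_ring_def)
  have "b \<noteq> 0" "d \<noteq> 0" using ab cd P_zero by auto
  then have "x + y = (a * d + c * b) / (b * d)" using ab cd by (simp add: add_frac_eq)
  then show ?thesis using ab cd by (simp add: local_ringI int_adjoin_closed P_mult)
qed

lemma local_max_add:
  assumes "x \<in> local_max" "y \<in> local_max"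
  shows "x + y \<in> local_max"
proof -
  obtain a b c d where ab: "x = a / b" "a \<in> P" "b \<in> R" "b \<notin> P"
    and cd: "y = c / d" "c \<in> P" "d \<in> R" "d \<notin> P"
    using assms by (auto simp: local_max_def)
  have "b \<noteq> 0" "d \<noteq> 0" using ab cd P_zero by auto
  then have "x + y = (a * d + c * b) / (b * d)" using ab cd by (simp add: add_frac_eq)
  then show ?thesis using ab cd by (simp add: local_maxI int_adjoin_closed P_closed P_mult)
qed

lemma local_max_mult:
  assumes "x \<in> local_max" "y \<in> local_ring"
  shows "x * y \<in> local_max"
proof -
  obtain a b c d where ab: "x = a / b" "a \<in> P" "b \<in> R" "b \<notin> P"
    and cd: "y = c / d" "c \<in> R" "d \<in> R" "d \<notin> P"
    using assms by (auto simp: local_max_def local_ring_def)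
  then show ?thesis by (simp add: local_maxI int_adjoin_closed P_closed P_mult)
qed

lemma loc_cong_refl: "x \<in> local_ring \<Longrightarrow> x \<approx> x"
  using local_maxI[of 0 1] P_one P_zero by (simp add: loc_cong_def int_adjoin_const)

lemma loc_cong_add: "x \<approx> y \<Longrightarrow> x' \<approx> y' \<Longrightarrow> x + x' \<approx> y + y'"
  using local_max_add[of "x - y" "x' - y'"]
  by (auto simp: loc_cong_def local_ring_add algebra_simps)

lemma loc_cong_mult:
  assumes "x \<approx> y" "x' \<approx> y'"
  shows "x * x' \<approx> y * y'"
proof -
  have "x * x' - y * y' = (x - y) * x' + (x' - y') * y" by (simp add: algebra_simps)
  also have "\<dots> \<in> local_max"
    using assms by (intro local_max_add local_max_mult) (auto simp: loc_cong_def)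
  finally show ?thesis using assms by (auto simp: loc_cong_def local_ring_mult)
qed

lemma loc_cong_power: "x \<approx> y \<Longrightarrow> x ^ m \<approx> y ^ m"
  by (induction m) (simp_all add: loc_cong_mult loc_cong_refl local_ring_R int_adjoin_const)

lemma loc_cong_prod: "(\<And>i. i \<in> A \<Longrightarrow> f i \<approx> g i) \<Longrightarrow> prod f A \<approx> prod g A"
  by (induction A rule: infinite_finite_induct)
    (simp_all add: loc_cong_mult loc_cong_refl local_ring_R int_adjoin_const)

lemma loc_cong_sum: "(\<And>i. i \<in> A \<Longrightarrow> f i \<approx> g i) \<Longrightarrow> sum f A \<approx> sum g A"
  by (induction A rule: infinite_finite_induct)
    (simp_all add: loc_cong_add loc_cong_refl local_ring_R int_adjoin_const)

text \<open>The difference of the inverses is \<open>- (x - y) / (x * y)\<close>. Its numerator is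
  in \<open>P\<close>; its denominator is not, because \<open>x\<close> avoids \<open>P\<close>
  together with \<open>y\<close> and \<open>P\<close> is prime.\<close>

lemma loc_cong_inverse:
  assumes "x \<in> R" "y \<in> R" "x - y \<in> P" "y \<notin> P"
  shows "1 / x \<approx> 1 / y"
proof -
  have x: "x \<notin> P" using P_closed(3)[of x "x - y"] assms by auto
  have "x \<noteq> 0" "y \<noteq> 0" using x assms P_zero by auto
  then have "1 / x - 1 / y = (- 1) * (x - y) / (x * y)" by (simp add: field_simps)
  also have "\<dots> \<in> local_max"
    using assms x by (intro local_maxI P_closed(5) P_mult int_adjoin_closed int_adjoin_uminus int_adjoin_const) auto
  finally show ?thesis
    using assms x by (simp add: loc_cong_def local_ringI int_adjoin_const)
qed

section \<open>Reduction modulo the prime ideal\<close>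

text \<open>Any fraction for \<open>x\<close> and any fraction for \<open>y\<close> give the same
  residue class. Hence the conditions inside the two definite descriptions are equivalent, and the
  descriptions agree.\<close>

lemma reduce_mod_eq:
  assumes "x \<approx> y"
  shows "reduce_mod (int_adjoin z) P x = reduce_mod (int_adjoin z) P y"
proof -
  interpret Q: field "int_adjoin z Quot P" by (rule quotient_field)
  interpret h: ring_hom_cring "int_adjoin z" "int_adjoin z Quot P" "(+>\<^bsub>int_adjoin z\<^esub>) P"
    by (rule rcos_ring_hom_cring)
  let ?h = "(+>\<^bsub>int_adjoin z\<^esub>) P" and ?Q = "int_adjoin z Quot P"
  have unit: "?h b \<in> Units ?Q" if "b \<in> R" "b \<notin> P" for b
  proof -
    have "?h b \<noteq> ?h 0" using that coset_eq_iff[of b 0] by (simp add: int_adjoin_const)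
    moreover have "?h 0 = \<zero>\<^bsub>?Q\<^esub>" using h.hom_zero by simp
    ultimately show ?thesis using that by (simp add: Q.field_Units)
  qed
  have val: "?h a \<otimes>\<^bsub>?Q\<^esub> inv\<^bsub>?Q\<^esub> ?h b = ?h c \<otimes>\<^bsub>?Q\<^esub> inv\<^bsub>?Q\<^esub> ?h d"
    if ab: "x = a / b" "a \<in> R" "b \<in> R" "b \<notin> P" and cd: "y = c / d" "c \<in> R" "d \<in> R" "d \<notin> P"
    for a b c d
  proof -
    obtain u v where uv: "x - y = u / v" "u \<in> P" "v \<in> R" "v \<notin> P"
      using assms by (auto simp: loc_cong_def local_max_def)
    have nz: "b \<noteq> 0" "d \<noteq> 0" "v \<noteq> 0" using ab cd uv P_zero by auto
    \<comment> \<open>Clearing denominators leaves the extra factor \<open>v\<close>; since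
      \<open>v\<close> is outside \<open>P\<close>, primality removes it again.\<close>
    have "v * (a * d - c * b) = u * (b * d)"
      using uv(1) nz unfolding ab cd by (simp add: field_simps)
    also have "\<dots> \<in> P" using uv ab cd by (simp add: P_closed(4) int_adjoin_closed)
    finally have "a * d - c * b \<in> P"
      using P_mult[of v "a * d - c * b"] uv ab cd by (auto simp: int_adjoin_closed)
    then have "?h (a * d) = ?h (c * b)"
      using coset_eq_iff[of "a * d" "c * b"] ab cd by (simp add: int_adjoin_closed)
    then have eq: "?h a \<otimes>\<^bsub>?Q\<^esub> ?h d = ?h c \<otimes>\<^bsub>?Q\<^esub> ?h b"
      using h.hom_mult[of a d] h.hom_mult[of c b] ab cd by simp
    note U = unit[OF ab(3,4)] unit[OF cd(3,4)]
    note C = h.hom_closed[OF ab(2)] h.hom_closed[OF ab(3)] h.hom_closed[OF cd(2)]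
      h.hom_closed[OF cd(3)] Q.Units_inv_closed[OF U(1)] Q.Units_inv_closed[OF U(2)]
    \<comment> \<open>Expand by the unit \<open>?h d\<close>, exchange the products by
      \<open>eq\<close>, then cancel the unit \<open>?h b\<close>.\<close>
    have "?h a \<otimes>\<^bsub>?Q\<^esub> inv\<^bsub>?Q\<^esub> ?h b
        = (?h a \<otimes>\<^bsub>?Q\<^esub> ?h d) \<otimes>\<^bsub>?Q\<^esub> (inv\<^bsub>?Q\<^esub> ?h b \<otimes>\<^bsub>?Q\<^esub> inv\<^bsub>?Q\<^esub> ?h d)"
      using C U by (simp add: Q.m_ac Q.Units_r_inv)
    also have "\<dots> = ?h c \<otimes>\<^bsub>?Q\<^esub> inv\<^bsub>?Q\<^esub> ?h d \<otimes>\<^bsub>?Q\<^esub> (?h b \<otimes>\<^bsub>?Q\<^esub> inv\<^bsub>?Q\<^esub> ?h b)"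
      unfolding eq using C by (simp add: Q.m_ac)
    also have "\<dots> = ?h c \<otimes>\<^bsub>?Q\<^esub> inv\<^bsub>?Q\<^esub> ?h d"
      using C U by (simp add: Q.Units_r_inv)
    finally show ?thesis .
  qed
  obtain a b where ab: "x = a / b" "a \<in> R" "b \<in> R" "b \<notin> P"
    using assms by (auto simp: loc_cong_def local_ring_def)
  obtain c d where cd: "y = c / d" "c \<in> R" "d \<in> R" "d \<notin> P"
    using assms by (auto simp: loc_cong_def local_ring_def)
  have "(\<exists>a\<in>R. \<exists>b\<in>R - P. x = a / b \<and> t = ?h a \<otimes>\<^bsub>?Q\<^esub> inv\<^bsub>?Q\<^esub> ?h b)
      \<longleftrightarrow> (\<exists>a\<in>R. \<exists>b\<in>R - P. y = a / b \<and> t = ?h a \<otimes>\<^bsub>?Q\<^esub> inv\<^bsub>?Q\<^esub> ?h b)" for t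
    using val ab cd by (metis DiffE DiffI)
  then show ?thesis unfolding reduce_mod_def by simp
qed

text \<open>By Bezout, \<open>1\<close> is an integral combination of \<open>m\<close> and
  \<open>p\<close>; were both in \<open>P\<close>, the ideal would contain \<open>1\<close>.\<close>

lemma of_nat_notin_P:
  assumes "Factorial_Ring.prime p" "0 < m" "m < p"
  shows "of_nat m \<notin> P"
proof
  assume m: "of_nat m \<in> P"
  have "coprime (int m) (int p)"
    using assms by (metis coprime_commute coprime_int_iff dvd_imp_le not_le prime_imp_coprime)
  then obtain u v where "u * int m + v * int p = 1"
    using bezout_int[of "int m" "int p"] by auto
  then have "of_int u * of_nat m + of_int v * of_nat p = (1 :: complex)"
    by (metis of_int_1 of_int_add of_int_mult of_int_of_nat_eq)
  moreover have "of_int u * of_nat m + of_int v * of_nat p \<in> P"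
    using m p_mem by (intro P_closed(2) P_closed(5) int_adjoin_of_int)
  ultimately show False using P_one by simp
qed

end

section \<open>Comparison of the two sums at each prime\<close>

theorem theorem4p2:
  fixes N r :: nat and \<alpha> :: int and k :: "nat list" and \<eta> :: "complex list"
    and \<zeta> :: "nat \<Rightarrow> complex" and P :: "nat \<Rightarrow> complex set"
    and \<iota> :: "nat \<Rightarrow> complex set \<Rightarrow> Fbar_elem"
  assumes "N \<ge> 1" and "coprime \<alpha> (int N)"
    and "length k = r" and "\<forall>i<r. k ! i > 0"
    and "length \<eta> = r" and "\<forall>i<r. (\<eta> ! i) ^ N = 1"
    and "\<And>n. n \<ge> 1 \<Longrightarrow> primitive_root_of_unity n (\<zeta> n)"
    and "\<And>p. p \<in> primes_cong N \<alpha> \<Longrightarrow> primeideal (P p) (int_adjoin (\<zeta> (p * N)))"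
    and "\<And>p. p \<in> primes_cong N \<alpha> \<Longrightarrow>
           P p \<inter> carrier (int_adjoin (\<zeta> p)) = PIdl\<^bsub>int_adjoin (\<zeta> p)\<^esub> (1 - \<zeta> p)"
    and "\<And>p. p \<in> primes_cong N \<alpha> \<Longrightarrow>
           \<iota> p \<in> ring_hom (int_adjoin (\<zeta> (p * N)) Quot P p) (Fbar p)"
    and "\<And>p. p \<in> primes_cong N \<alpha> \<Longrightarrow>
           inj_on (\<iota> p) (carrier (int_adjoin (\<zeta> (p * N)) Quot P p))"
  shows "finite_colored_mzv N \<alpha> \<zeta> P \<iota> \<eta> k
           = class_A N \<alpha> (mod_family N \<zeta> P \<iota> (\<lambda>p. z_sum \<eta> k p (\<zeta> p)))"
  unfolding finite_colored_mzv_def class_A_def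
proof (rule arg_cong[where f = "\<lambda>f. _ +>\<^bsub>_\<^esub> f"], rule restrict_ext)
  \<comment> \<open>The representing families themselves coincide at every index, so their cosets
    modulo the direct sum do too.\<close>
  fix p assume p: "p \<in> primes_cong N \<alpha>"
  define w where "w = \<zeta> (p * N)"
  define y where "y = \<zeta> p"
  have prime: "Factorial_Ring.prime p" using p by (simp add: primes_cong_def)
  then have p1: "p > 1" by (rule prime_gt_1_nat)
  have w: "primitive_root_of_unity (p * N) w"
    using assms(1,7) p1 unfolding w_def by simp
  have y: "primitive_root_of_unity p y"
    using assms(7) p1 unfolding y_def by simp
  have wpow: "w ^ (p * N) = 1" and ypow: "y ^ p = 1" and y1: "y \<noteq> 1"
    using w y p1 by (auto simp: primitive_root_of_unity_def dest: spec[of _ 1])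
  \<comment> \<open>No compatibility between \<open>\<zeta> p\<close> and
    \<open>\<zeta> (p * N)\<close> is assumed. Both \<open>\<zeta> p\<close> and the entries of
    \<open>\<eta>\<close> lie in the ring because their orders divide \<open>p * N\<close>, which
    makes them powers of \<open>w\<close>.\<close>
  have mem: "x \<in> carrier (int_adjoin w)" if "x ^ (p * N) = 1" for x
    using primitive_root_of_unity_powers[OF w that]
    by (metis int_adjoin_power int_adjoin_generator)
  have yR: "y \<in> carrier (int_adjoin w)"
    using ypow by (intro mem) (simp add: power_mult)
  interpret prm: primeideal "P p" "int_adjoin w"
    using assms(8)[OF p] unfolding w_def .
  \<comment> \<open>Only the intersection of the prime with the smaller ring
    \<open>int_adjoin y\<close> is given; the generator \<open>1 - y\<close> of that intersection is
    extracted from it.\<close>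
  have y_mem: "1 - y \<in> P p"
  proof -
    interpret Y: cring "int_adjoin y" by (rule int_adjoin_cring)
    have "1 - y \<in> PIdl\<^bsub>int_adjoin y\<^esub> (1 - y)"
      by (intro Y.cgenideal_self int_adjoin_closed int_adjoin_const int_adjoin_generator)
    then show ?thesis using assms(9)[OF p] unfolding y_def by blast
  qed
  have geom_mem: "(\<Sum>i<m. y ^ i) - of_nat m \<in> P p" for m
  proof -
    \<comment> \<open>The cofactor in \<open>y ^ i - 1 = (1 - y) * ?s i\<close>; it shows that each
      power of \<open>y\<close> is \<open>1\<close> modulo the prime.\<close>
    let ?s = "\<lambda>i. - (\<Sum>j<i. y ^ j)"
    have "(\<Sum>i<m. y ^ i) - of_nat m = (\<Sum>i<m. y ^ i - 1)"
      by (simp add: sum_subtractf)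
    also have "\<dots> = (1 - y) * (\<Sum>i<m. ?s i)"
      unfolding sum_distrib_left
      by (intro sum.cong refl) (simp add: power_diff_1_eq algebra_simps)
    also have "\<dots> \<in> P p"
      using prm.I_r_closed[OF y_mem, of "\<Sum>i<m. ?s i"] yR
      by (simp add: int_adjoin_sum int_adjoin_uminus int_adjoin_power del: sum_negf)
    finally show ?thesis .
  qed
  \<comment> \<open>For \<open>m = p\<close> the geometric sum vanishes, so \<open>geom_mem\<close>
    says that \<open>- p\<close> is in the prime. This yields the residue characteristic required by
    the locale.\<close>
  have "(\<Sum>i<p. y ^ i) = 0"
    using ypow y1 power_diff_1_eq[of y p] by simp
  then have "(- 1) * (- of_nat p) \<in> P p"
    using prm.I_l_closed[of "- of_nat p" "- 1"] geom_mem[of p]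
    by (simp add: int_adjoin_const int_adjoin_uminus)
  then interpret residue_char_prime w "P p" "p * N" p
    using wpow p1 assms(1) by unfold_locales auto
  have factor: "loc_cong (1 / of_nat m) ((1 - y) / (1 - y ^ m))" if m: "0 < m" "m < p" for m
  proof -
    have notin: "(of_nat m :: complex) \<notin> P p" using of_nat_notin_P[OF prime m] .
    have geomR: "(\<Sum>i<m. y ^ i) \<in> R" using yR by (intro int_adjoin_sum int_adjoin_power)
    have "(\<Sum>i<m. y ^ i) \<notin> P p"
      using notin geom_mem[of m] P_closed(3)[of "\<Sum>i<m. y ^ i" "(\<Sum>i<m. y ^ i) - of_nat m"] by auto
    moreover have "of_nat m - (\<Sum>i<m. y ^ i) \<in> P p"
      using P_closed(3)[OF P_zero geom_mem[of m]] by simp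
    ultimately have "loc_cong (1 / of_nat m) (1 / (\<Sum>i<m. y ^ i))"
      using geomR by (intro loc_cong_inverse int_adjoin_of_nat)
    \<comment> \<open>Both \<open>1 - y\<close> and \<open>1 - y ^ m\<close> lie in the prime, so
      their quotient cannot be reduced separately in numerator and denominator. As a complex number
      \<open>1 - y\<close> is nonzero and cancels, leaving the inverse of the geometric sum, which
      is outside the prime.\<close>
    moreover have "1 - y ^ m = (1 - y) * (\<Sum>i<m. y ^ i)"
      by (rule one_diff_power_eq)
    ultimately show ?thesis using y1 by simp
  qed
  \<comment> \<open>Distributing the denominator over the factors gives this sum the shape of
    \<open>z_sum\<close>, with \<open>1 / m\<close> in place of
    \<open>(1 - y) / (1 - y ^ m)\<close>; the powers of \<open>\<eta>\<close> are the same on both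
    sides.\<close>
  have "colored_sum \<eta> k p =
      (\<Sum>m\<in>decreasing_tuples p (length k). \<Prod>j<length k. (\<eta> ! j) ^ (m ! j) * (1 / of_nat (m ! j)) ^ (k ! j))"
    unfolding colored_sum_def by (simp add: prod_dividef power_one_over)
  also have "loc_cong \<dots> (z_sum \<eta> k p y)"
    unfolding z_sum_def
  proof (intro loc_cong_sum loc_cong_prod loc_cong_mult loc_cong_power loc_cong_refl local_ring_R
      int_adjoin_power)
    fix m j assume m: "m \<in> decreasing_tuples p (length k)" and j: "j \<in> {..<length k}"
    show "\<eta> ! j \<in> R"
      using assms(3,6) j by (intro mem) (simp add: power_mult mult.commute[of p])
    have "m ! j \<in> {0<..<p}"
      using m j unfolding decreasing_tuples_def by (auto simp: subset_iff)
    then show "loc_cong (1 / of_nat (m ! j)) ((1 - y) / (1 - y ^ (m ! j)))"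
      by (intro factor) auto
  qed
  finally show "mod_family N \<zeta> P \<iota> (colored_sum \<eta> k) p
      = mod_family N \<zeta> P \<iota> (\<lambda>p. z_sum \<eta> k p (\<zeta> p)) p"
    unfolding mod_family_def w_def[symmetric] y_def[symmetric] by (simp add: reduce_mod_eq)
qed

end
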